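(* Let $0<\delta<1/2$ be a constant. There is a constant $C$, depending only on $\delta$, such that for all sufficiently large $n$, every integer $m$ with $\delta\binom n2\le m\le(1-\delta)\binom n2$, and every positive integer $k\le\frac{\log n}{8}$, $$\mathbb E[X_{n,m}^k]\le C^k\,(\mathbb E[X_{n,m}])^k,$$ where $X_{n,m}$ is the number of Hamilton cycles in $G(n,m)$.
   Context: $G(n,m)$ is the random graph chosen uniformly at random from the set of all graphs on vertex set $[n]=\{1,\dots,n\}$ with exactly $m$ edges. Hamilton cycles are counted as (undirected) subgraphs. $\log$ is the natural logarithm. *)

theory Defs
  imports "HOL-Probability.Probability"
begin

text \<open>A graph on the fixed vertex set \<open>{1..n}\<close> is identified with its set of edges,
  an edge being a two-element set of vertices.\<close>

definition all_edges :: "nat \<Rightarrow> nat set set" where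
  "all_edges n = {e. e \<subseteq> {1..n} \<and> card e = 2}"

definition graphs :: "nat \<Rightarrow> nat \<Rightarrow> nat set set set" where
  "graphs n m = {E. E \<subseteq> all_edges n \<and> card E = m}"

text \<open>As \<open>pmf_of_set\<close> requires, \<open>graphs n m\<close> is finite; it is nonempty exactly when
  \<open>m \<le> n choose 2\<close>.\<close>

definition Gnm :: "nat \<Rightarrow> nat \<Rightarrow> nat set set pmf" where
  "Gnm n m = pmf_of_set (graphs n m)"

definition cycle_edges :: "'a list \<Rightarrow> 'a set set" where
  "cycle_edges vs = {{vs ! i, vs ! (Suc i mod length vs)} | i. i < length vs}"

text \<open>A Hamilton cycle is a subgraph, that is, an edge set, so the rotations and the reversal
  of a listing of its vertices all give the same Hamilton cycle.\<close>

definition hamilton_cycle :: "nat \<Rightarrow> nat set set \<Rightarrow> bool" where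
  "hamilton_cycle n H \<longleftrightarrow>
     (\<exists>vs. distinct vs \<and> set vs = {1..n} \<and> length vs \<ge> 3 \<and> H = cycle_edges vs)"

definition num_hamilton_cycles :: "nat \<Rightarrow> nat set set \<Rightarrow> nat" where
  "num_hamilton_cycles n E = card {H. H \<subseteq> E \<and> hamilton_cycle n H}"

end

theory Submission
  imports Defs "HOL-Combinatorics.Multiset_Permutations" "HOL-Real_Asymp.Real_Asymp"
begin

text \<open>Expanding the \<open>k\<close>-th moment one Hamilton cycle at a time, it suffices that conditioning on
  \<open>F \<subseteq> G(n,m)\<close>, where \<open>|F| \<le> (k - 1) n\<close>, raises the expected number of Hamilton cycles by at most a
  constant factor. Put \<open>M = n choose 2\<close>, \<open>f = |F|\<close> and \<open>x = (M - m) / (m - f - n)\<close>. A Hamilton cycle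
  \<open>H\<close> gains a factor at most \<open>1 + x\<close> for each edge shared with \<open>F\<close>, while the conditioning costs
  \<open>exp (- n f (M - m) / (m M))\<close>. A given set of \<open>a\<close> edges lies in at most a fraction
  \<open>2^a (n - a - 1)! / (n - 1)!\<close>, roughly \<open>(2 / n)^a\<close>, of all Hamilton cycles, so expanding
  \<open>(1 + x)^|F \<inter> H|\<close> over subsets of \<open>F \<inter> H\<close> shows that its mean over \<open>H\<close> is
  \<open>O(exp (2 x f / n))\<close>. The two exponents cancel up to \<open>O((log n)^2 / n)\<close>.\<close>

section \<open>Listings of Hamilton cycles\<close>

text \<open>The directed form of \<open>cycle_edges\<close>: each edge is traversed in the direction
  of the listing. In a distinct listing every vertex then has a unique predecessor, which makes the
  listings through prescribed arcs easy to count.\<close>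

definition cycle_arcs :: "'a list \<Rightarrow> ('a \<times> 'a) set" where
  "cycle_arcs vs = (\<lambda>i. (vs ! i, vs ! (Suc i mod length vs))) ` {..<length vs}"

lemma cycle_edges_conv_arcs: "cycle_edges vs = (\<lambda>(x, y). {x, y}) ` cycle_arcs vs"
  unfolding cycle_edges_def cycle_arcs_def by auto

lemma cycle_arcs_rotate_subset: "cycle_arcs (rotate k vs) \<subseteq> cycle_arcs vs"
proof
  fix e assume "e \<in> cycle_arcs (rotate k vs)"
  then obtain i where i: "i < length vs"
    "e = (rotate k vs ! i, rotate k vs ! (Suc i mod length vs))"
    unfolding cycle_arcs_def by auto
  have pos: "length vs > 0" using i by auto
  let ?j = "(k + i) mod length vs"
  have "rotate k vs ! (Suc i mod length vs) = vs ! (Suc ?j mod length vs)"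
    using pos by (simp add: nth_rotate mod_simps)
  moreover have "rotate k vs ! i = vs ! ?j" using i by (simp add: nth_rotate)
  ultimately show "e \<in> cycle_arcs vs"
    unfolding cycle_arcs_def using i pos by (auto intro!: image_eqI[of _ _ ?j])
qed

lemma rotate_inverse:
  assumes "k \<le> length vs"
  shows "rotate (length vs - k) (rotate k vs) = vs"
  using assms by (simp add: rotate_rotate)

lemma cycle_arcs_rotate:
  assumes "k \<le> length vs"
  shows "cycle_arcs (rotate k vs) = cycle_arcs vs"
  using cycle_arcs_rotate_subset[of k vs]
    cycle_arcs_rotate_subset[of "length vs - k" "rotate k vs"]
  by (simp add: rotate_inverse[OF assms])

text \<open>The cyclic successor is injective on positions, so an arc is determined by its head. A
  set of arcs inside one cycle therefore has as many heads as arcs.\<close>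

lemma snd_inj_on_cycle_arcs:
  assumes "distinct vs"
  shows "inj_on snd (cycle_arcs vs)"
proof (rule inj_onI)
  fix e e' assume "e \<in> cycle_arcs vs" "e' \<in> cycle_arcs vs" "snd e = snd e'"
  then obtain i j where ij: "i < length vs" "j < length vs"
    "e = (vs ! i, vs ! (Suc i mod length vs))" "e' = (vs ! j, vs ! (Suc j mod length vs))"
    "vs ! (Suc i mod length vs) = vs ! (Suc j mod length vs)"
    unfolding cycle_arcs_def by auto
  have "Suc i mod length vs < length vs" "Suc j mod length vs < length vs"
    using ij by (auto intro: mod_less_divisor)
  with ij assms have "Suc i mod length vs = Suc j mod length vs"
    by (simp add: nth_eq_iff_index_eq)
  hence "i = j" using ij by (auto simp: mod_Suc split: if_splits)
  thus "e = e'" using ij by simp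
qed

lemma snd_cycle_arcs_subset: "snd ` cycle_arcs vs \<subseteq> set vs"
proof -
  have "Suc i mod length vs < length vs" if "i < length vs" for i
    using that by (auto intro: mod_less_divisor)
  thus ?thesis unfolding cycle_arcs_def by auto
qed

section \<open>Listings through prescribed arcs and edges\<close>

text \<open>An element of \<open>T\<close> can only follow its prescribed predecessor, so deleting \<open>T\<close> loses nothing.\<close>

lemma eq_if_filter_eq:
  assumes "distinct vs" "distinct ws" "set vs = set ws"
    and pv: "\<And>i. i < length vs \<Longrightarrow> vs ! i \<in> T \<Longrightarrow> i > 0 \<and> vs ! (i - 1) = u (vs ! i)"
    and pw: "\<And>i. i < length ws \<Longrightarrow> ws ! i \<in> T \<Longrightarrow> i > 0 \<and> ws ! (i - 1) = u (ws ! i)"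
    and filt: "filter (\<lambda>x. x \<notin> T) vs = filter (\<lambda>x. x \<notin> T) ws"
  shows "vs = ws"
proof -
  have len: "length vs = length ws" using assms(1-3) by (metis distinct_card)
  \<comment> \<open>Stated for two generic lists, since the element of \<open>T\<close> may be met
    in either listing first. Its predecessor is at position \<open>i - 1\<close> in both lists, so
    by distinctness the element itself is at position \<open>i\<close> in both.\<close>
  have step: "b ! i = a ! i"
    if a: "distinct a" "distinct b" "set a = set b" "length a = length b" "i < length a" "a ! i \<in> T"
      "take i a = take i b"
      "\<And>i. i < length a \<Longrightarrow> a ! i \<in> T \<Longrightarrow> i > 0 \<and> a ! (i - 1) = u (a ! i)"
      "\<And>i. i < length b \<Longrightarrow> b ! i \<in> T \<Longrightarrow> i > 0 \<and> b ! (i - 1) = u (b ! i)"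
    for a b :: "'a list" and i
  proof -
    have i0: "i > 0" "a ! (i - 1) = u (a ! i)" using a by auto
    have "a ! i \<in> set b" using a by (metis nth_mem)
    then obtain j where j: "j < length b" "b ! j = a ! i" by (auto simp: in_set_conv_nth)
    hence j0: "j > 0" "b ! (j - 1) = u (a ! i)" using a(6) a(9)[of j] by auto
    have "a ! (i - 1) = b ! (i - 1)"
      using i0 a(7) by (metis diff_less nth_take zero_less_one)
    hence "b ! (j - 1) = b ! (i - 1)" using i0 j0 by simp
    hence "j - 1 = i - 1" using a(2,4,5) j i0 j0 by (simp add: nth_eq_iff_index_eq)
    hence "i = j" using i0 j0 by simp
    thus ?thesis using j by simp
  qed
  have "take i vs = take i ws" if "i \<le> length vs" for i
    using that
  proof (induction i)
    case (Suc i)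
    hence IH: "take i vs = take i ws" and i: "i < length vs" "i < length ws" using len by auto
    have "vs ! i = ws ! i"
    proof -
      consider "vs ! i \<in> T" | "ws ! i \<in> T" | "vs ! i \<notin> T" "ws ! i \<notin> T" by blast
      thus ?thesis
      proof cases
        case 1
        thus ?thesis using step[of vs ws i] assms IH i len by auto
      next
        case 2
        thus ?thesis using step[of ws vs i] assms IH i len by auto
      next
        \<comment> \<open>Past the common prefix, both filtered lists continue with their own
          \<open>i\<close>-th entry, so these entries agree.\<close>
        case 3
        have "vs = take i vs @ vs ! i # drop (Suc i) vs"
             "ws = take i ws @ ws ! i # drop (Suc i) ws"
          using i by (simp_all add: id_take_nth_drop[symmetric])
        hence "filter (\<lambda>x. x \<notin> T) vs = filter (\<lambda>x. x \<notin> T) (take i vs) @ vs ! i # filter (\<lambda>x. x \<notin> T) (drop (Suc i) vs)"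
              "filter (\<lambda>x. x \<notin> T) ws = filter (\<lambda>x. x \<notin> T) (take i ws) @ ws ! i # filter (\<lambda>x. x \<notin> T) (drop (Suc i) ws)"
          using 3 by (metis filter.simps(2) filter_append)+
        thus ?thesis using IH filt by simp
      qed
    qed
    thus ?case using IH i by (simp add: take_Suc_conv_app_nth)
  qed simp
  from this[of "length vs"] show ?thesis using len by simp
qed

text \<open>Rotate a listing so that it starts at a vertex \<open>r\<close> that is not the head of
  an arc of \<open>B\<close>; this costs the factor \<open>card S\<close>. Deleting \<open>r\<close>
  and all heads then leaves an ordering of \<open>card S - card B - 1\<close> vertices, from which
  the listing can be recovered.\<close>

lemma card_permutations_containing_arcs_less:
  assumes fin: "finite S" and B: "card B < card S"
  shows "card {vs \<in> permutations_of_set S. B \<subseteq> cycle_arcs vs}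
           \<le> card S * fact (card S - card B - 1)"
proof (cases "{vs \<in> permutations_of_set S. B \<subseteq> cycle_arcs vs} = {}")
  case True
  thus ?thesis by (simp only: card.empty)
next
  case False
  \<comment> \<open>One listing through \<open>B\<close> is enough to know that the arcs of
    \<open>B\<close> have distinct heads, so that \<open>T\<close> has the size of \<open>B\<close>
    and the predecessor map \<open>u\<close> is well defined on it.\<close>
  then obtain v0 where v0: "distinct v0" "set v0 = S" "B \<subseteq> cycle_arcs v0"
    by (auto simp: permutations_of_set_def)
  define T where "T = snd ` B"
  have injB: "inj_on snd B"
    using snd_inj_on_cycle_arcs[OF v0(1)] v0(3) by (rule inj_on_subset)
  have cT: "card T = card B" unfolding T_def by (rule card_image[OF injB])
  have TS: "T \<subseteq> S" unfolding T_def using v0 snd_cycle_arcs_subset[of v0] by auto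
  obtain r where r: "r \<in> S" "r \<notin> T"
    using B cT fin by (metis TS card_mono finite_subset leD subsetI)
  define u where "u = (\<lambda>t. THE x. (x, t) \<in> B)"
  have u: "u t = x" if "(x, t) \<in> B" for x t
    unfolding u_def using that inj_onD[OF injB, of _ "(x, t)"] by (intro the_equality) auto
  define W where "W = {vs \<in> permutations_of_set S. B \<subseteq> cycle_arcs vs \<and> vs ! 0 = r}"
  have Wfin: "finite W" unfolding W_def by (simp add: fin)
  \<comment> \<open>The recorded number is the shift undoing the rotation that brings
    \<open>r\<close> to the front; it takes at most \<open>card S\<close> values.\<close>
  have "{vs \<in> permutations_of_set S. B \<subseteq> cycle_arcs vs} \<subseteq> (\<lambda>(i, vs). rotate i vs) ` ({1..card S} \<times> W)"
  proof
    fix vs assume "vs \<in> {vs \<in> permutations_of_set S. B \<subseteq> cycle_arcs vs}"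
    hence vs: "distinct vs" "set vs = S" "B \<subseteq> cycle_arcs vs" by (auto simp: permutations_of_set_def)
    then obtain i where i: "i < length vs" "vs ! i = r" using r by (metis in_set_conv_nth)
    have len: "length vs = card S" using vs by (metis distinct_card)
    have "rotate i vs ! 0 = vs ! ((i + 0) mod length vs)" using i by (intro nth_rotate) auto
    hence "rotate i vs ! 0 = r" using i by simp
    moreover have "B \<subseteq> cycle_arcs (rotate i vs)" using vs i by (simp add: cycle_arcs_rotate)
    ultimately have "rotate i vs \<in> W"
      unfolding W_def permutations_of_set_def using vs(1,2) by simp
    moreover have "vs = rotate (length vs - i) (rotate i vs)" using rotate_inverse[of i vs] i by simp
    ultimately show "vs \<in> (\<lambda>(i, vs). rotate i vs) ` ({1..card S} \<times> W)"
      using i len by (intro image_eqI[of _ _ "(length vs - i, rotate i vs)"]) auto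
  qed
  hence "card {vs \<in> permutations_of_set S. B \<subseteq> cycle_arcs vs} \<le> card ({1..card S} \<times> W)"
    using Wfin by (intro surj_card_le) auto
  hence 1: "card {vs \<in> permutations_of_set S. B \<subseteq> cycle_arcs vs} \<le> card S * card W"
    by (simp add: card_cartesian_product)
  have pred: "i > 0 \<and> vs ! (i - 1) = u (vs ! i)" if "vs \<in> W" "i < length vs" "vs ! i \<in> T" for vs i
  proof -
    have vs: "distinct vs" "set vs = S" "B \<subseteq> cycle_arcs vs" "vs ! 0 = r"
      using that by (auto simp: W_def permutations_of_set_def)
    have i0: "i > 0" using that vs r by (cases i) auto
    have "vs ! i \<in> snd ` B" using that T_def by simp
    then obtain x where x: "(x, vs ! i) \<in> B" by auto
    hence "(x, vs ! i) \<in> cycle_arcs vs" using vs by auto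
    moreover have "(vs ! (i - 1), vs ! i) \<in> cycle_arcs vs"
      unfolding cycle_arcs_def using i0 that by (intro image_eqI[of _ _ "i - 1"]) auto
    ultimately have "x = vs ! (i - 1)"
      using inj_onD[OF snd_inj_on_cycle_arcs[OF vs(1)], of "(x, vs ! i)" "(vs ! (i - 1), vs ! i)"] by simp
    thus ?thesis using i0 u[OF x] by simp
  qed
  have inj: "inj_on (\<lambda>vs. tl (filter (\<lambda>x. x \<notin> T) vs)) W"
  proof (rule inj_onI)
    fix vs ws assume vw: "vs \<in> W" "ws \<in> W"
      and eq: "tl (filter (\<lambda>x. x \<notin> T) vs) = tl (filter (\<lambda>x. x \<notin> T) ws)"
    have "filter (\<lambda>x. x \<notin> T) zs = r # tl (filter (\<lambda>x. x \<notin> T) zs)" if "zs \<in> W" for zs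
    proof -
      have "zs ! 0 = r" "zs \<noteq> []" using that r by (auto simp: W_def permutations_of_set_def)
      thus ?thesis using r by (cases zs) auto
    qed
    hence "filter (\<lambda>x. x \<notin> T) vs = filter (\<lambda>x. x \<notin> T) ws" using vw eq by metis
    thus "vs = ws"
      using vw pred by (intro eq_if_filter_eq[of vs ws T u]) (auto simp: W_def permutations_of_set_def)
  qed
  have "(\<lambda>vs. tl (filter (\<lambda>x. x \<notin> T) vs)) ` W \<subseteq> permutations_of_set (S - T - {r})"
  proof safe
    fix vs assume "vs \<in> W"
    hence vs: "distinct vs" "set vs = S" "vs ! 0 = r" by (auto simp: W_def permutations_of_set_def)
    then obtain zs where zs: "vs = r # zs" using r by (cases vs) auto
    show "tl (filter (\<lambda>x. x \<notin> T) vs) \<in> permutations_of_set (S - T - {r})"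
      using vs r unfolding zs permutations_of_set_def by auto
  qed
  hence "card W \<le> card (permutations_of_set (S - T - {r}))"
    using inj fin by (intro card_inj_on_le) auto
  also have "\<dots> = fact (card (S - T - {r}))" using fin by simp
  also have "card (S - T - {r}) = card S - card B - 1"
    using fin TS r cT by (simp add: card_Diff_subset finite_subset)
  finally show ?thesis using 1 by (meson le_trans mult_le_mono2)
qed

text \<open>If \<open>B\<close> has as many arcs as there are vertices, no starting vertex outside
  the heads remains. Dropping one arc reduces this to the previous bound, and by truncated
  subtraction the factorial is \<open>fact 0\<close> before and after.\<close>

lemma card_permutations_containing_arcs:
  assumes fin: "finite S" and B: "card B \<le> card S" "S \<noteq> {}"
  shows "card {vs \<in> permutations_of_set S. B \<subseteq> cycle_arcs vs}
           \<le> card S * fact (card S - card B - 1)"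
proof (cases "card B = card S")
  case True
  have pos: "card S > 0" using assms by (simp add: card_gt_0_iff)
  hence "card S - 1 \<le> card B" using True by simp
  then obtain B' where B': "B' \<subseteq> B" "card B' = card S - 1"
    using obtain_subset_with_card_n by metis
  have "card {vs \<in> permutations_of_set S. B \<subseteq> cycle_arcs vs}
    \<le> card {vs \<in> permutations_of_set S. B' \<subseteq> cycle_arcs vs}"
    using B' fin by (intro card_mono) auto
  also have "\<dots> \<le> card S * fact (card S - card B' - 1)"
    using B' pos by (intro card_permutations_containing_arcs_less fin) auto
  finally show ?thesis using True B' pos by simp
next
  case False
  thus ?thesis using assms by (intro card_permutations_containing_arcs_less) auto
qed

text \<open>A listing traverses each edge of \<open>A\<close> in one of two directions. The bound is
  a union bound over the \<open>2 ^ card A\<close> orientations collected in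
  \<open>Or\<close>.\<close>

lemma card_permutations_containing_edges:
  assumes fin: "finite S" and A: "card A \<le> card S" "S \<noteq> {}" "finite A" "\<And>e. e \<in> A \<Longrightarrow> card e = 2"
  shows "card {vs \<in> permutations_of_set S. A \<subseteq> cycle_edges vs}
           \<le> 2 ^ card A * (card S * fact (card S - card A - 1))"
proof -
  define Or where "Or = PiE A (\<lambda>e. {(x, y). {x, y} = e})"
  have two: "finite {(x, y). {x, y} = e} \<and> card {(x, y). {x, y} = e} = 2" if "e \<in> A" for e
  proof -
    have "card e = 2" using A(4) that by blast
    then obtain a b where ab: "e = {a, b}" "a \<noteq> b" by (auto simp: card_2_iff)
    have "{(x, y). {x, y} = e} = {(a, b), (b, a)}" using ab by (auto simp: doubleton_eq_iff)
    thus ?thesis using ab by simp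
  qed
  have finOr: "finite Or" unfolding Or_def using two A by (intro finite_PiE) auto
  have cOr: "card Or = 2 ^ card A"
    unfolding Or_def using two A by (simp add: card_PiE)
  \<comment> \<open>An arc determines its underlying edge, so orienting \<open>A\<close> keeps its
    size.\<close>
  have hB: "card (h ` A) = card A" if "h \<in> Or" for h
  proof (rule card_image, rule inj_onI)
    fix e e' assume e: "e \<in> A" "e' \<in> A" "h e = h e'"
    have "h e \<in> {(x, y). {x, y} = e}" "h e' \<in> {(x, y). {x, y} = e'}"
      by (fact e(1,2)[THEN PiE_mem[OF that[unfolded Or_def]]])+
    thus "e = e'" using e by auto
  qed
  have "{vs \<in> permutations_of_set S. A \<subseteq> cycle_edges vs}
     \<subseteq> (\<Union>h\<in>Or. {vs \<in> permutations_of_set S. h ` A \<subseteq> cycle_arcs vs})"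
  proof
    fix vs assume "vs \<in> {vs \<in> permutations_of_set S. A \<subseteq> cycle_edges vs}"
    hence vs: "vs \<in> permutations_of_set S" "A \<subseteq> cycle_edges vs" by auto
    have "\<forall>e\<in>A. \<exists>p. p \<in> cycle_arcs vs \<and> {fst p, snd p} = e"
      using vs(2) unfolding cycle_edges_conv_arcs by (fastforce simp: split_beta)
    from bchoice[OF this] obtain h where h: "\<forall>e\<in>A. h e \<in> cycle_arcs vs \<and> {fst (h e), snd (h e)} = e"
      by blast
    have "h e \<in> {(x, y). {x, y} = e}" if "e \<in> A" for e
      using bspec[OF h that] by (cases "h e") simp
    hence "restrict h A \<in> Or" unfolding Or_def by (simp add: PiE_iff)
    moreover have "restrict h A ` A \<subseteq> cycle_arcs vs" using h by (simp add: image_subset_iff)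
    ultimately show "vs \<in> (\<Union>h\<in>Or. {vs \<in> permutations_of_set S. h ` A \<subseteq> cycle_arcs vs})"
      using vs by blast
  qed
  hence "card {vs \<in> permutations_of_set S. A \<subseteq> cycle_edges vs}
     \<le> card (\<Union>h\<in>Or. {vs \<in> permutations_of_set S. h ` A \<subseteq> cycle_arcs vs})"
    using finOr fin by (intro card_mono) auto
  also have "\<dots> \<le> (\<Sum>h\<in>Or. card {vs \<in> permutations_of_set S. h ` A \<subseteq> cycle_arcs vs})"
    by (rule card_UN_le[OF finOr])
  also have "\<dots> \<le> (\<Sum>h\<in>Or. card S * fact (card S - card A - 1))"
  proof (rule sum_mono)
    fix h assume h: "h \<in> Or"
    show "card {vs \<in> permutations_of_set S. h ` A \<subseteq> cycle_arcs vs} \<le> card S * fact (card S - card A - 1)"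
      using card_permutations_containing_arcs[of S "h ` A"] fin A hB[OF h] by simp
  qed
  also have "\<dots> = 2 ^ card A * (card S * fact (card S - card A - 1))" using cOr by simp
  finally show ?thesis .
qed

section \<open>Relabelling listings, and the edges of a cycle\<close>

lemma cycle_edges_conv_image:
  "cycle_edges vs = (\<lambda>i. {vs ! i, vs ! (Suc i mod length vs)}) ` {..<length vs}"
  unfolding cycle_edges_def by auto

lemma cycle_edges_map: "cycle_edges (map p vs) = (`) p ` cycle_edges vs"
  unfolding cycle_edges_conv_image image_image
proof (rule image_cong, goal_cases)
  case (2 i)
  hence i: "i < length vs" by simp
  hence "Suc i mod length vs < length vs" by (auto intro: mod_less_divisor)
  hence "map p vs ! (Suc i mod length vs) = p (vs ! (Suc i mod length vs))" by (rule nth_map)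
  moreover have "map p vs ! i = p (vs ! i)" using i by (rule nth_map)
  ultimately show ?case by (simp only: length_map image_insert image_empty)
qed simp

text \<open>The relabelling \<open>p\<close> that carries \<open>vs\<close> to \<open>ws\<close>
  maps listings of the first cycle injectively to listings of the second. Applied both ways, this
  shows that all Hamilton cycles have equally many listings, a number that never has to be
  computed.\<close>

lemma card_listings_le:
  assumes "finite S" "vs \<in> permutations_of_set S" "ws \<in> permutations_of_set S"
  shows "card {us \<in> permutations_of_set S. cycle_edges us = cycle_edges vs}
       \<le> card {us \<in> permutations_of_set S. cycle_edges us = cycle_edges ws}"
proof -
  have vs: "distinct vs" "set vs = S" and ws: "distinct ws" "set ws = S"
    using assms by (auto simp: permutations_of_set_def)
  have len: "length vs = length ws" using vs ws by (metis distinct_card)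
  define p where "p = (\<lambda>x. ws ! inv_into {..<length vs} ((!) vs) x)"
  have "inv_into {..<length vs} ((!) vs) (vs ! i) = i" if "i < length vs" for i
    using that vs by (intro inv_into_f_f) (auto simp: inj_on_nth)
  hence mp: "map p vs = ws" unfolding p_def using len by (intro nth_equalityI) auto
  hence injp: "inj_on p S" using ws vs by (metis distinct_map)
  have pS: "p ` S = S" using mp vs ws by (metis set_map)
  have "inj_on (map p) {us \<in> permutations_of_set S. cycle_edges us = cycle_edges vs}"
    using injp by (intro inj_onI) (auto simp: permutations_of_set_def intro: map_inj_on)
  moreover have "map p ` {us \<in> permutations_of_set S. cycle_edges us = cycle_edges vs}
      \<subseteq> {us \<in> permutations_of_set S. cycle_edges us = cycle_edges ws}"
    using injp pS by (auto simp: permutations_of_set_def distinct_map cycle_edges_map mp[symmetric])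
  ultimately show ?thesis using assms(1) by (intro card_inj_on_le) auto
qed

text \<open>If two different positions gave the same edge, each would be the cyclic successor of the
  other, which is impossible for length at least 3.\<close>

lemma card_cycle_edges:
  assumes "distinct vs" "length vs \<ge> 3"
  shows "card (cycle_edges vs) = length vs"
proof -
  let ?n = "length vs"
  have "inj_on (\<lambda>i. {vs ! i, vs ! (Suc i mod ?n)}) {..<?n}"
  proof (rule inj_onI)
    fix i j assume ij: "i \<in> {..<?n}" "j \<in> {..<?n}"
      and eq: "{vs ! i, vs ! (Suc i mod ?n)} = {vs ! j, vs ! (Suc j mod ?n)}"
    have lt: "Suc i mod ?n < ?n" "Suc j mod ?n < ?n" using assms by (auto intro: mod_less_divisor)
    show "i = j"
    proof (rule ccontr)
      assume "i \<noteq> j"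
      hence "vs ! i \<noteq> vs ! j" using assms ij by (simp add: nth_eq_iff_index_eq)
      hence "vs ! i = vs ! (Suc j mod ?n)" "vs ! (Suc i mod ?n) = vs ! j"
        using eq by (auto simp: doubleton_eq_iff)
      hence "i = Suc j mod ?n" "Suc i mod ?n = j"
        using assms ij lt by (simp_all add: nth_eq_iff_index_eq)
      thus False using assms ij by (auto simp: mod_Suc split: if_splits)
    qed
  qed
  thus ?thesis unfolding cycle_edges_conv_image by (simp add: card_image)
qed

lemma cycle_edges_subset:
  assumes "distinct vs" "length vs \<ge> 2" "e \<in> cycle_edges vs"
  shows "e \<subseteq> set vs" "card e = 2"
proof -
  obtain i where i: "i < length vs" "e = {vs ! i, vs ! (Suc i mod length vs)}"
    using assms by (auto simp: cycle_edges_def)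
  have lt: "Suc i mod length vs < length vs" using assms by (auto intro: mod_less_divisor)
  show "e \<subseteq> set vs" using i lt by auto
  have "i \<noteq> Suc i mod length vs" using i assms by (auto simp: mod_Suc)
  hence "vs ! i \<noteq> vs ! (Suc i mod length vs)" using assms i lt by (simp add: nth_eq_iff_index_eq)
  thus "card e = 2" using i by simp
qed

section \<open>Overlap of a random Hamilton cycle with a fixed graph\<close>

definition hams :: "nat \<Rightarrow> nat set set set" where
  "hams n = {H. hamilton_cycle n H}"

lemma hams_conv_image:
  assumes "n \<ge> 3"
  shows "hams n = cycle_edges ` permutations_of_set {1..n}"
proof -
  have "length vs = n" if "distinct vs" "set vs = {1..n}" for vs :: "nat list"
    using distinct_card[OF that(1)] that(2) by simp
  thus ?thesis
    unfolding hams_def hamilton_cycle_def permutations_of_set_def using assms by auto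
qed

lemma finite_all_edges: "finite (all_edges n)"
  by (rule finite_subset[of _ "Pow {1..n}"]) (auto simp: all_edges_def)

lemma card_all_edges: "card (all_edges n) = n choose 2"
  unfolding all_edges_def using n_subsets[of "{1..n}" 2] by simp

lemma finite_hams:
  assumes "n \<ge> 3"
  shows "finite (hams n)"
  using hams_conv_image[OF assms] by simp

lemma hams_memD:
  assumes "n \<ge> 3" "H \<in> hams n"
  shows "H \<subseteq> all_edges n" "card H = n"
proof -
  obtain vs where vs: "distinct vs" "set vs = {1..n}" "H = cycle_edges vs"
    using assms hams_conv_image[of n] by (auto simp: permutations_of_set_def)
  have len: "length vs = n" using distinct_card[OF vs(1)] vs(2) by simp
  show "card H = n" using card_cycle_edges[OF vs(1)] len assms vs by simp
  show "H \<subseteq> all_edges n"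
  proof
    fix e assume "e \<in> H"
    thus "e \<in> all_edges n"
      using cycle_edges_subset[OF vs(1), of e] len assms vs by (simp add: all_edges_def)
  qed
qed

text \<open>Every Hamilton cycle has the same number \<open>D\<close> of listings, so the fraction
  of cycles containing \<open>A\<close> equals the fraction of the \<open>fact n\<close> listings
  that do, and the count of listings applies.\<close>

lemma card_hams_containing:
  assumes n: "n \<ge> 3" and A: "A \<subseteq> all_edges n" "card A \<le> n"
  shows "real (card {H \<in> hams n. A \<subseteq> H})
    \<le> real (card (hams n)) * (2 ^ card A * (real n * fact (n - card A - 1)) / fact n)"
proof -
  define P where "P = permutations_of_set {1..n}"
  have finP: "finite P" and cP: "card P = fact n" unfolding P_def by simp_all
  obtain v0 where v0: "v0 \<in> P" using cP by (metis card.empty ex_in_conv fact_nonzero)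
  define D where "D = card {us \<in> P. cycle_edges us = cycle_edges v0}"
  have "{us \<in> P. cycle_edges us = cycle_edges v0} \<noteq> {}" using v0 by blast
  hence Dpos: "D > 0" unfolding D_def using finP by (simp add: card_gt_0_iff)
  have D: "card {us \<in> P. cycle_edges us = H} = D" if "H \<in> hams n" for H
  proof -
    have "H \<in> cycle_edges ` P" using that hams_conv_image[OF n] P_def by simp
    then obtain vs where "vs \<in> P" "H = cycle_edges vs" by blast
    thus ?thesis unfolding D_def using card_listings_le[of "{1..n}" vs v0]
        card_listings_le[of "{1..n}" v0 vs] v0 by (simp add: P_def)
  qed
  \<comment> \<open>The set \<open>A\<close> is arbitrary here: the empty set will give the total
    number of listings.\<close>
  have count: "card {vs \<in> P. A \<subseteq> cycle_edges vs} = card {H \<in> hams n. A \<subseteq> H} * D" for A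
  proof -
    have im: "cycle_edges ` {vs \<in> P. A \<subseteq> cycle_edges vs} = {H \<in> hams n. A \<subseteq> H}"
      using n by (auto simp: hams_conv_image P_def)
    have "card {vs \<in> P. A \<subseteq> cycle_edges vs}
        = (\<Sum>H\<in>{H \<in> hams n. A \<subseteq> H}. card {vs \<in> {vs \<in> P. A \<subseteq> cycle_edges vs}. cycle_edges vs = H})"
      unfolding card_eq_sum im[symmetric] using finP by (intro sum.image_gen) simp
    also have "\<dots> = (\<Sum>H\<in>{H \<in> hams n. A \<subseteq> H}. D)"
    proof (rule sum.cong[OF refl])
      fix H assume H: "H \<in> {H \<in> hams n. A \<subseteq> H}"
      hence "{vs \<in> {vs \<in> P. A \<subseteq> cycle_edges vs}. cycle_edges vs = H} = {vs \<in> P. cycle_edges vs = H}" by auto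
      thus "card {vs \<in> {vs \<in> P. A \<subseteq> cycle_edges vs}. cycle_edges vs = H} = D" using D H by simp
    qed
    finally show ?thesis by simp
  qed
  have total: "fact n = card (hams n) * D" using count[of "{}"] cP by simp
  have "finite A" using A finite_all_edges finite_subset by blast
  hence "card {vs \<in> P. A \<subseteq> cycle_edges vs} \<le> 2 ^ card A * (n * fact (n - card A - 1))"
    using card_permutations_containing_edges[of "{1..n}" A] A n
    by (auto simp: P_def all_edges_def)
  hence "card {H \<in> hams n. A \<subseteq> H} * D \<le> 2 ^ card A * (n * fact (n - card A - 1))"
    using count by simp
  hence "card {H \<in> hams n. A \<subseteq> H} * D * card (hams n) \<le> 2 ^ card A * (n * fact (n - card A - 1)) * card (hams n)"
    by (rule mult_le_mono1)
  hence "card {H \<in> hams n. A \<subseteq> H} * fact n \<le> card (hams n) * (2 ^ card A * (n * fact (n - card A - 1)))"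
    unfolding total by (simp add: mult_ac)
  hence "real (card {H \<in> hams n. A \<subseteq> H} * fact n) \<le> real (card (hams n) * (2 ^ card A * (n * fact (n - card A - 1))))"
    by (simp only: of_nat_le_iff)
  hence "real (card {H \<in> hams n. A \<subseteq> H}) * fact n \<le> real (card (hams n)) * (2 ^ card A * (real n * fact (n - card A - 1)))"
    by simp
  thus ?thesis by (simp add: pos_le_divide_eq)
qed

section \<open>Weights of fixed edge sets and the overlap generating function\<close>

lemma sum_Pow_power_card:
  fixes y :: real
  assumes "finite F"
  shows "(\<Sum>A\<in>Pow F. y ^ card A) = (1 + y) ^ card F"
  using prod_add[OF assms, of "\<lambda>_. y" "\<lambda>_. 1"] by (simp add: add.commute)

lemma fact_mult_power_le: "fact b * (b + 1) ^ a \<le> (fact (b + a) :: nat)"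
proof (induction a)
  case (Suc a)
  have "fact b * (b + 1) ^ Suc a = (b + 1) * (fact b * (b + 1) ^ a)" by (simp only: power_Suc mult_ac)
  also have "\<dots> \<le> (b + a + 1) * fact (b + a)" by (rule mult_le_mono[OF _ Suc.IH]) simp
  finally show ?case by simp
qed simp

text \<open>The weight is \<open>2 ^ a\<close> divided by the product of \<open>n - 1\<close> down
  to \<open>n - a\<close>. That product is at least \<open>(n - a) ^ a\<close>, and Bernoulli's
  inequality bounds \<open>(1 - a / n) ^ a\<close> below by 1/2 because \<open>a * a\<close> is at
  most \<open>n / 2\<close>.\<close>

lemma weight_le_small:
  assumes "n \<ge> 3" "2 * a\<^sup>2 \<le> n"
  shows "2 ^ a * (real n * fact (n - a - 1)) / fact n \<le> 2 * (2 / real n) ^ a"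
proof -
  have an: "a < n"
  proof (cases a)
    case (Suc b)
    have "a * 1 \<le> a * a" using Suc by (intro mult_le_mono2) simp
    thus ?thesis using assms Suc by (simp add: power2_eq_square)
  qed (use assms in simp)
  have "fact (n - a - 1) * (n - a) ^ a \<le> (fact (n - 1) :: nat)"
  proof -
    have "n - a - 1 + 1 = n - a" "n - a - 1 + a = n - 1" using an by auto
    thus ?thesis using fact_mult_power_le[of "n - a - 1" a] by metis
  qed
  hence "real (fact (n - a - 1) * (n - a) ^ a) \<le> real (fact (n - 1))" by (simp only: of_nat_le_iff)
  hence 1: "fact (n - a - 1) * (real n - real a) ^ a \<le> (fact (n - 1) :: real)"
    using an by (simp add: of_nat_diff)
  have "1 + real a * (- (real a / real n)) \<le> (1 + - (real a / real n)) ^ a"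
    using an by (intro Bernoulli_inequality) simp
  moreover have "real a * (real a / real n) \<le> 1 / 2"
  proof -
    have "real (2 * a\<^sup>2) \<le> real n" using assms(2) by (simp only: of_nat_le_iff)
    thus ?thesis using assms(1) by (simp add: field_simps power2_eq_square)
  qed
  ultimately have "1 / 2 \<le> (1 - real a / real n) ^ a" by simp
  hence "real n ^ a * (1 / 2) \<le> real n ^ a * (1 - real a / real n) ^ a"
    by (intro mult_left_mono) auto
  also have "\<dots> = (real n - real a) ^ a"
    using assms by (simp add: power_mult_distrib[symmetric] right_diff_distrib)
  finally have 2: "real n ^ a * (1 / 2) \<le> (real n - real a) ^ a" .
  have "fact (n - a - 1) * (real n ^ a * (1 / 2)) \<le> (fact (n - 1) :: real)"
    by (rule order_trans[OF mult_left_mono[OF 2] 1]) simp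
  moreover have "fact n = real n * fact (n - 1)" using assms fact_reduce[of n] by simp
  moreover have "real n > 0" using assms by simp
  ultimately show ?thesis by (simp add: power_divide field_simps)
qed

text \<open>The quotient of \<open>a ^ a\<close> by \<open>fact a\<close> is a single term of the
  exponential series at \<open>a\<close>.\<close>

lemma power_self_le_exp_fact: "real a ^ a \<le> exp (real a) * fact a"
proof -
  have "(\<Sum>k\<in>{a}. real a ^ k /\<^sub>R fact k) \<le> (\<Sum>k. real a ^ k /\<^sub>R fact k)"
    by (intro sum_le_suminf summable_exp_generic) auto
  hence "real a ^ a / fact a \<le> exp (real a)" by (simp add: exp_def field_simps)
  thus ?thesis by (simp add: pos_divide_le_eq)
qed

text \<open>A cruder bound without a restriction on the square of \<open>a\<close>:
  \<open>fact n / fact (n - a)\<close> equals \<open>fact a * (n choose a)\<close>, which is at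
  least \<open>fact a * (n / a) ^ a\<close> for positive \<open>a\<close> and hence at least
  \<open>(n / e) ^ a\<close>. Compared with small \<open>a\<close>, it loses about
  \<open>n * exp a\<close>.\<close>

lemma weight_le_large:
  assumes "n \<ge> 3" "a \<le> n"
  shows "2 ^ a * (real n * fact (n - a - 1)) / fact n \<le> real n * (2 * exp 1 / real n) ^ a"
proof -
  have "fact a * fact (n - a) * (n choose a) = (fact n :: nat)"
    by (rule binomial_fact_lemma[OF assms(2)])
  hence fn: "(fact n :: real) = fact a * fact (n - a) * real (n choose a)"
    by (metis of_nat_fact of_nat_mult)
  have "real n ^ a \<le> real a ^ a * real (n choose a)"
  proof (cases "a = 0")
    case False
    thus ?thesis using binomial_ge_n_over_k_pow_k[OF assms(2), where 'a = real]
      by (simp add: power_divide field_simps)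
  qed simp
  also have "\<dots> \<le> exp (real a) * fact a * real (n choose a)"
    by (intro mult_right_mono power_self_le_exp_fact) simp
  finally have "real n ^ a * fact (n - a) \<le> exp (real a) * fact a * real (n choose a) * fact (n - a)"
    by (rule mult_right_mono) simp
  hence "real n ^ a * fact (n - a) \<le> exp (real a) * fact n" unfolding fn by (simp add: mult_ac)
  moreover have "(fact (n - a - 1) :: real) \<le> fact (n - a)" by (rule fact_mono) simp
  ultimately have "real n ^ a * fact (n - a - 1) \<le> exp (real a) * fact n"
    by (meson mult_left_mono order_trans zero_le_power of_nat_0_le_iff)
  moreover have "exp (real a) = exp 1 ^ a" using exp_of_nat_mult[of a "1::real"] by simp
  ultimately have "real n ^ a * fact (n - a - 1) \<le> exp 1 ^ a * fact n" by simp
  hence "fact (n - a - 1) / fact n \<le> exp 1 ^ a / real n ^ a"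
    using assms by (simp add: field_simps)
  hence "(2 ^ a * real n) * (fact (n - a - 1) / fact n) \<le> (2 ^ a * real n) * (exp 1 ^ a / real n ^ a)"
    by (intro mult_left_mono) auto
  thus ?thesis by (simp add: power_divide power_mult_distrib mult_ac)
qed

text \<open>The overlap of a random Hamilton cycle with \<open>F\<close> behaves like a Poisson variable of mean
  \<open>2 |F| / n\<close>.\<close>

lemma sum_hams_power_overlap:
  fixes x :: real
  assumes n: "n \<ge> 3" and F: "F \<subseteq> all_edges n" and x: "x \<ge> 0"
    and large: "real n * exp (exp 2 * (2 * x * card F / n)) \<le> exp (sqrt (n / 2))"
  shows "(\<Sum>H\<in>hams n. (1 + x) ^ card (F \<inter> H)) \<le> real (card (hams n)) * (3 * exp (2 * x * card F / n))"
proof -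
  have finF: "finite F" using F finite_all_edges finite_subset by blast
  have finh: "finite (hams n)" by (rule finite_hams[OF n])
  have n0: "real n > 0" using n by simp
  \<comment> \<open>Each power is a sum of \<open>x ^ card A\<close> over the subsets
    \<open>A\<close> of \<open>F \<inter> H\<close>; exchanging the sums leaves the number of
    Hamilton cycles containing \<open>A\<close>.\<close>
  have expand: "(\<Sum>H\<in>hams n. (1 + x) ^ card (F \<inter> H))
      = (\<Sum>A\<in>Pow F. x ^ card A * card {H \<in> hams n. A \<subseteq> H})"
  proof -
    have "(1 + x) ^ card (F \<inter> H) = (\<Sum>A\<in>Pow F. if A \<subseteq> H then x ^ card A else 0)" for H
    proof -
      have "(1 + x) ^ card (F \<inter> H) = (\<Sum>A\<in>Pow (F \<inter> H). x ^ card A)"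
        using finF by (intro sum_Pow_power_card[symmetric]) simp
      also have "Pow (F \<inter> H) = {A \<in> Pow F. A \<subseteq> H}" by auto
      also have "(\<Sum>A\<in>\<dots>. x ^ card A) = (\<Sum>A\<in>Pow F. if A \<subseteq> H then x ^ card A else 0)"
        using finF by (intro sum.inter_filter) simp
      finally show ?thesis .
    qed
    hence "(\<Sum>H\<in>hams n. (1 + x) ^ card (F \<inter> H))
      = (\<Sum>A\<in>Pow F. \<Sum>H\<in>hams n. if A \<subseteq> H then x ^ card A else 0)"
      by (simp add: sum.swap[of _ "Pow F"])
    also have "\<dots> = (\<Sum>A\<in>Pow F. \<Sum>H\<in>{H \<in> hams n. A \<subseteq> H}. x ^ card A)"
      by (intro sum.cong refl sum.inter_filter[symmetric] finh)
    finally show ?thesis by (simp add: mult.commute)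
  qed
  \<comment> \<open>Here \<open>y\<close> is the weight per edge for small \<open>A\<close>. For
    large \<open>A\<close> it becomes \<open>z\<close>, with two additional factors
    \<open>e\<close>: one from the cruder weight bound, the other from trading
    \<open>exp (card A)\<close> for the small prefactor \<beta>.\<close>
  define y where "y = 2 * x / n"
  define z where "z = exp 2 * (2 * x / n)"
  have yz: "y \<ge> 0" "z \<ge> 0" using x by (simp_all add: y_def z_def)
  define c where "c = real (card (hams n))"
  define \<beta> where "\<beta> = real n * exp (- sqrt (n / 2))"
  have term_le: "x ^ card A * card {H \<in> hams n. A \<subseteq> H} \<le> c * (2 * y ^ card A + \<beta> * z ^ card A)"
    if A: "A \<in> Pow F" for A
  proof (cases "card A \<le> n")
    case False
    have "{H \<in> hams n. A \<subseteq> H} = {}"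
    proof (rule ccontr)
      assume "{H \<in> hams n. A \<subseteq> H} \<noteq> {}"
      then obtain H where H: "H \<in> hams n" "A \<subseteq> H" by blast
      hence "card H = n" "finite H" using hams_memD[OF n] finite_all_edges finite_subset by blast+
      thus False using card_mono[of H A] H False by simp
    qed
    moreover have "0 \<le> c * (2 * y ^ card A + \<beta> * z ^ card A)" using yz by (simp add: c_def \<beta>_def)
    ultimately show ?thesis by (simp only: card.empty of_nat_0 mult_zero_right)
  next
    case True
    let ?a = "card A" and ?w = "2 ^ card A * (real n * fact (n - card A - 1)) / fact n"
    have "A \<subseteq> all_edges n" using A F by auto
    hence "real (card {H \<in> hams n. A \<subseteq> H}) \<le> c * ?w"
      using card_hams_containing[OF n _ True] by (simp add: c_def)
    hence le: "x ^ ?a * card {H \<in> hams n. A \<subseteq> H} \<le> x ^ ?a * (c * ?w)"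
      using x by (intro mult_left_mono) auto
    have "x ^ ?a * ?w \<le> 2 * y ^ ?a + \<beta> * z ^ ?a"
    proof (cases "2 * ?a\<^sup>2 \<le> n")
      case True
      have "x ^ ?a * ?w \<le> x ^ ?a * (2 * (2 / real n) ^ ?a)"
        using x by (intro mult_left_mono weight_le_small n True) auto
      also have "\<dots> = 2 * y ^ ?a" by (simp add: y_def power_divide power_mult_distrib)
      also have "\<dots> \<le> 2 * y ^ ?a + \<beta> * z ^ ?a" using yz by (simp add: \<beta>_def)
      finally show ?thesis .
    next
      case False
      \<comment> \<open>Now the size of \<open>A\<close> is at least \<open>sqrt (n / 2)\<close>, so
        multiplying by \<open>exp (card A - sqrt (n / 2))\<close> can only enlarge the
        bound.\<close>
      have "real n \<le> real (2 * ?a\<^sup>2)" using False by (simp only: of_nat_le_iff)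
      hence "sqrt (n / 2) \<le> ?a" by (intro real_le_lsqrt) auto
      hence e: "1 \<le> exp (- sqrt (n / 2)) * exp ?a" by (simp add: exp_add[symmetric])
      have "x ^ ?a * ?w \<le> x ^ ?a * (real n * (2 * exp 1 / real n) ^ ?a)"
        using x by (intro mult_left_mono weight_le_large n True) auto
      also have "\<dots> \<le> x ^ ?a * (real n * (2 * exp 1 / real n) ^ ?a) * (exp (- sqrt (n / 2)) * exp ?a)"
        using e x mult_left_mono[OF e, of "x ^ ?a * (real n * (2 * exp 1 / real n) ^ ?a)"] by simp
      also have "\<dots> = \<beta> * (x * (2 * exp 1 / n) * exp 1) ^ ?a"
        using exp_of_nat_mult[of ?a "1::real"] by (simp add: \<beta>_def power_mult_distrib power_divide)
      also have "x * (2 * exp 1 / n) * exp 1 = z"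
        using exp_add[of 1 "1::real"] by (simp add: z_def)
      also have "\<beta> * z ^ ?a \<le> 2 * y ^ ?a + \<beta> * z ^ ?a" using yz by simp
      finally show ?thesis .
    qed
    hence "c * (x ^ ?a * ?w) \<le> c * (2 * y ^ ?a + \<beta> * z ^ ?a)"
      by (intro mult_left_mono) (auto simp: c_def)
    thus ?thesis using le by (simp add: mult_ac)
  qed
  have pow_exp: "(1 + t) ^ card F \<le> exp (t * card F)" if "t \<ge> 0" for t :: real
  proof -
    have "(1 + t) ^ card F \<le> exp t ^ card F" using that by (intro power_mono) auto
    thus ?thesis by (simp add: exp_of_nat_mult[symmetric] mult.commute)
  qed
  have "(\<Sum>H\<in>hams n. (1 + x) ^ card (F \<inter> H)) \<le> (\<Sum>A\<in>Pow F. c * (2 * y ^ card A + \<beta> * z ^ card A))"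
    unfolding expand by (rule sum_mono) (rule term_le)
  also have "\<dots> = c * (2 * (1 + y) ^ card F + \<beta> * (1 + z) ^ card F)"
    using sum_Pow_power_card[OF finF] by (simp add: sum_distrib_left[symmetric] sum.distrib)
  also have "\<dots> \<le> c * (2 * exp (y * card F) + \<beta> * exp (z * card F))"
    using yz pow_exp by (intro mult_left_mono add_mono) (auto simp: c_def \<beta>_def)
  \<comment> \<open>The assumption \<open>large\<close> says exactly that the contribution of large
    \<open>A\<close> is at most 1. It is then absorbed into the main term, turning the factor 2 into
    3.\<close>
  also have "\<beta> * exp (z * card F) \<le> 1"
  proof -
    have "\<beta> * exp (z * card F) = (real n * exp (exp 2 * (2 * x * card F / n))) * exp (- sqrt (n / 2))"
      by (simp add: \<beta>_def z_def mult_ac)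
    also have "\<dots> \<le> exp (sqrt (n / 2)) * exp (- sqrt (n / 2))" by (rule mult_right_mono[OF large]) simp
    also have "\<dots> = 1" by (simp add: exp_add[symmetric])
    finally show ?thesis .
  qed
  also have "1 \<le> exp (y * card F)" using yz by simp
  finally have "(\<Sum>H\<in>hams n. (1 + x) ^ card (F \<inter> H)) \<le> c * (2 * exp (y * card F) + exp (y * card F))"
    by (simp add: c_def mult_left_mono)
  thus ?thesis by (simp add: c_def y_def)
qed

section \<open>Containment probabilities\<close>

text \<open>Conditioning on the presence of \<open>F\<close> is expressed by counting these graphs,
  so that no conditional distribution has to be formed.\<close>

definition supergraphs :: "nat \<Rightarrow> nat \<Rightarrow> nat set set \<Rightarrow> nat set set set" where
  "supergraphs n m F = {E \<in> graphs n m. F \<subseteq> E}"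

lemma finite_graphs: "finite (graphs n m)"
  by (rule finite_subset[of _ "Pow (all_edges n)"]) (auto simp: graphs_def finite_all_edges)

lemma finite_supergraphs: "finite (supergraphs n m F)"
  by (simp add: supergraphs_def finite_graphs)

lemma card_supergraphs:
  assumes F: "F \<subseteq> all_edges n" and f: "card F \<le> m"
  shows "card (supergraphs n m F) = ((n choose 2) - card F) choose (m - card F)"
proof -
  have finF: "finite F" using F finite_all_edges finite_subset by blast
  have fin: "finite E" if "E \<subseteq> all_edges n" for E using that finite_all_edges finite_subset by blast
  have "bij_betw (\<lambda>E. E - F) (supergraphs n m F) {D. D \<subseteq> all_edges n - F \<and> card D = m - card F}"
  proof (rule bij_betw_byWitness[where f' = "\<lambda>D. D \<union> F"])
    show "(\<lambda>E. E - F) ` supergraphs n m F \<subseteq> {D. D \<subseteq> all_edges n - F \<and> card D = m - card F}"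
      using finF by (auto simp: supergraphs_def graphs_def card_Diff_subset)
    show "(\<lambda>D. D \<union> F) ` {D. D \<subseteq> all_edges n - F \<and> card D = m - card F} \<subseteq> supergraphs n m F"
    proof safe
      fix D assume D: "D \<subseteq> all_edges n - F" "card D = m - card F"
      hence "D \<inter> F = {}" "finite D" using fin[of D] by auto
      hence "card (D \<union> F) = m" using D f finF by (simp add: card_Un_disjoint)
      thus "D \<union> F \<in> supergraphs n m F" using D F by (auto simp: supergraphs_def graphs_def)
    qed
  qed (auto simp: supergraphs_def)
  hence "card (supergraphs n m F) = card {D. D \<subseteq> all_edges n - F \<and> card D = m - card F}"
    by (rule bij_betw_same_card)
  also have "\<dots> = card (all_edges n - F) choose (m - card F)"
    using finite_all_edges by (intro n_subsets) simp
  also have "card (all_edges n - F) = (n choose 2) - card F"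
    using F finF by (simp add: card_Diff_subset card_all_edges)
  finally show ?thesis .
qed

section \<open>Inclusion probabilities as products\<close>

text \<open>A ratio of falling factorials: for \<open>M = n choose 2\<close> and
  \<open>j \<le> m \<le> M\<close>, the probability that \<open>j\<close> given edges all occur in
  the random graph.\<close>

definition inclusion_prob :: "nat \<Rightarrow> nat \<Rightarrow> nat \<Rightarrow> real" where
  "inclusion_prob M m j = (\<Prod>i<j. (real m - real i) / (real M - real i))"

lemma binomial_diff_conv_inclusion_prob:
  assumes "j \<le> m" "m \<le> M"
  shows "real ((M - j) choose (m - j)) = real (M choose m) * inclusion_prob M m j"
  using assms
proof (induction j)
  case (Suc j)
  hence "M - j = Suc (M - Suc j)" "m - j = Suc (m - Suc j)" by auto
  hence "(m - j) * ((M - j) choose (m - j)) = (M - j) * ((M - Suc j) choose (m - Suc j))"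
    using Suc_times_binomial[of "m - Suc j" "M - Suc j"] by metis
  hence "real (m - j) * real ((M - j) choose (m - j)) = real (M - j) * real ((M - Suc j) choose (m - Suc j))"
    by (metis of_nat_mult)
  moreover have "real (M - j) > 0" using Suc.prems by simp
  ultimately have "real ((M - Suc j) choose (m - Suc j))
      = real ((M - j) choose (m - j)) * (real (m - j) / real (M - j))"
    by (simp add: field_simps)
  thus ?case using Suc by (simp add: inclusion_prob_def of_nat_diff)
qed (simp add: inclusion_prob_def)

lemma inclusion_prob_nonneg:
  assumes "j \<le> m" "m \<le> M"
  shows "inclusion_prob M m j \<ge> 0"
  unfolding inclusion_prob_def using assms by (intro prod_nonneg) auto

text \<open>The factors of the product decrease with the index because \<open>m \<le> M\<close>, so
  the one at \<open>t\<close> bounds the next \<open>s\<close> factors from below. This prices the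
  edges that a Hamilton cycle shares with \<open>F\<close>.\<close>

lemma inclusion_prob_mult_power_le:
  assumes "j + s \<le> t" "t < m" "m \<le> M"
  shows "inclusion_prob M m j * ((real m - real t) / (real M - real t)) ^ s \<le> inclusion_prob M m (j + s)"
  using assms(1)
proof (induction s)
  case (Suc s)
  let ?q = "(real m - real t) / (real M - real t)"
  have *: "?q \<le> (real m - real (j + s)) / (real M - real (j + s))"
  proof -
    define d where "d = real t - real (j + s)"
    have d: "d \<ge> 0" using Suc.prems by (simp add: d_def)
    have eq: "real m - real (j + s) = real m - real t + d" "real M - real (j + s) = real M - real t + d"
      by (simp_all add: d_def)
    define a b where "a = real m - real t" and "b = real M - real t"
    have ab: "0 < a" "a \<le> b" using assms by (auto simp: a_def b_def)
    have "a * d \<le> b * d" using ab d by (intro mult_right_mono)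
    hence "a * (b + d) \<le> (a + d) * b" by (simp add: algebra_simps)
    thus ?thesis unfolding eq a_def[symmetric] b_def[symmetric] using ab d by (simp add: divide_simps)
  qed
  have "inclusion_prob M m j * ?q ^ Suc s = (inclusion_prob M m j * ?q ^ s) * ?q" by simp
  also have "\<dots> \<le> inclusion_prob M m (j + s) * ((real m - real (j + s)) / (real M - real (j + s)))"
    using Suc assms by (intro mult_mono * Suc.IH inclusion_prob_nonneg) auto
  also have "\<dots> = inclusion_prob M m (j + Suc s)" by (simp add: inclusion_prob_def)
  finally show ?case .
qed simp

text \<open>Negative correlation of edges. With \<open>a = m - i\<close> and
  \<open>b = M - i\<close>, the shifted factor \<open>(a - f) / (b - f)\<close> is
  \<open>a / b\<close> times \<open>1 - f * (M - m) / (a * (b - f))\<close>; enlarging that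
  denominator to \<open>m * M\<close> gives the same exponential saving for each of the
  \<open>n\<close> factors.\<close>

lemma inclusion_prob_add_le:
  assumes "f + n < m" "m \<le> M"
  shows "inclusion_prob M m (f + n)
    \<le> inclusion_prob M m f * inclusion_prob M m n * exp (- (real n * (real f * (real M - real m) / (real m * real M))))"
  using assms(1)
proof (induction n)
  case (Suc n)
  let ?e = "real f * (real M - real m) / (real m * real M)"
  define a b where "a = real m - real n" and "b = real M - real n"
  have ab: "a > real f" "a \<le> b" "a \<le> real m" "b \<le> real M" using Suc.prems assms by (auto simp: a_def b_def)
  have pos: "a > 0" "b - real f > 0" "b > 0" using ab by linarith+
  have "(a - f) / (b - f) = (a / b) * (1 - f * (b - a) / (a * (b - f)))"
    using pos by (simp add: field_simps)
  also have "\<dots> \<le> (a / b) * (1 - f * (b - a) / (real m * real M))"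
    using pos ab by (intro mult_left_mono diff_left_mono divide_left_mono mult_mono) auto
  also have "b - a = real M - real m" by (simp add: a_def b_def)
  also have "(a / b) * (1 - ?e) \<le> (a / b) * exp (- ?e)"
    using pos exp_ge_add_one_self[of "- ?e"] by (intro mult_left_mono) auto
  finally have *: "(real m - real (f + n)) / (real M - real (f + n))
      \<le> (real m - real n) / (real M - real n) * exp (- ?e)"
    by (simp add: a_def b_def algebra_simps)
  have "inclusion_prob M m (f + Suc n)
      = inclusion_prob M m (f + n) * ((real m - real (f + n)) / (real M - real (f + n)))"
    by (simp add: inclusion_prob_def)
  also have "\<dots> \<le> (inclusion_prob M m f * inclusion_prob M m n * exp (- (real n * ?e)))
      * ((real m - real n) / (real M - real n) * exp (- ?e))"
    using Suc assms by (intro mult_mono * Suc.IH mult_nonneg_nonneg inclusion_prob_nonneg) auto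
  also have "\<dots> = inclusion_prob M m f * inclusion_prob M m (Suc n) * (exp (- (real n * ?e)) * exp (- ?e))"
    by (simp add: inclusion_prob_def mult_ac)
  also have "exp (- (real n * ?e)) * exp (- ?e) = exp (- (real (Suc n) * ?e))"
    unfolding exp_add[symmetric] by (simp only: of_nat_Suc distrib_right mult_1 minus_add_distrib add.commute)
  finally show ?case .
qed (simp add: inclusion_prob_def)

section \<open>Moments\<close>

lemma real_choose_two: "real (n choose 2) = real n * (real n - 1) / 2"
proof -
  have "even (n * (n - 1))" by (cases n) auto
  hence "real (n choose 2) = real (n * (n - 1)) / 2" by (simp add: choose_two real_of_nat_div)
  thus ?thesis by (cases n) (auto simp: algebra_simps)
qed

lemma choose_two_ge:
  assumes "n \<ge> 2"
  shows "real n ^ 2 / 4 \<le> real (n choose 2)"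
proof -
  have "real n * (real n / 2) \<le> real n * (real n - 1)" using assms by (intro mult_left_mono) auto
  thus ?thesis unfolding real_choose_two by (simp add: power2_eq_square)
qed

text \<open>The left-hand side is the budget for edges fixed during the expansion of the moment.
  Keeping it below \<open>m / 2\<close> ensures that \<open>m - f - n\<close> stays comparable to
  \<open>m\<close>.\<close>

lemma mult_less_half_edges:
  fixes \<delta> L :: real
  assumes "\<delta> > 0" "n \<ge> 2" "\<delta> * real (n choose 2) \<le> real m" "L < \<delta> * n"
  shows "real n * L / 8 < real m / 2"
proof -
  have "real n * L < real n * (\<delta> * n)" using assms by (intro mult_strict_left_mono) auto
  moreover have "\<delta> * (real n ^ 2 / 4) \<le> \<delta> * real (n choose 2)"
    using assms by (intro mult_left_mono choose_two_ge) auto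
  ultimately show ?thesis using assms(3) by (simp add: power2_eq_square mult_ac)
qed

text \<open>One step of the expansion: conditioning on \<open>F\<close> raises the expected number
  of Hamilton cycles at most by the factor \<open>3 * exp 1\<close>, with 3 from the overlap bound
  and \<open>exp 1\<close> from the uncancelled exponent. The conditions on \<open>L\<close>, later
  \<open>ln n\<close>, serve in turn to keep the edge budget below \<open>m / 2\<close>, to bound
  that exponent, and to control large overlaps.\<close>

lemma sum_card_supergraphs_hams:
  fixes \<delta> L :: real
  assumes \<delta>: "0 < \<delta>" and n: "n \<ge> 3"
    and m: "\<delta> * real (n choose 2) \<le> real m" "m \<le> n choose 2"
    and F: "F \<subseteq> all_edges n" "real (card F) + real n \<le> real n * L / 8"
    and L: "L < \<delta> * n" "L\<^sup>2 \<le> 4 * \<delta>\<^sup>2 * n"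
      "real n * exp (exp 2 * (L / (2 * \<delta>))) \<le> exp (sqrt (n / 2))"
  shows "(\<Sum>H\<in>hams n. real (card (supergraphs n m (F \<union> H))))
    \<le> 3 * exp 1 * (real (card (hams n)) * inclusion_prob (n choose 2) m n) * real (card (supergraphs n m F))"
proof -
  define M where "M = n choose 2"
  define f where "f = card F"
  have finF: "finite F" using F finite_all_edges finite_subset by blast
  have n0: "real n > 0" using n by simp
  have M: "real M = real n * (real n - 1) / 2" unfolding M_def by (rule real_choose_two)
  have M4: "real n ^ 2 / 4 \<le> real M" unfolding M_def using n by (intro choose_two_ge) simp
  have M0: "real M > 0" using n unfolding M by simp
  have mM: "\<delta> * real M \<le> real m" "m \<le> M" using m by (simp_all add: M_def)
  have m4: "\<delta> * real n ^ 2 / 4 \<le> real m"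
    using order_trans[OF mult_left_mono[OF M4 less_imp_le[OF \<delta>]] mM(1)] by simp
  have m0: "real m > 0" using mult_pos_pos[OF \<delta> M0] mM(1) by linarith
  have "0 < real n * L" using F(2) n0 by linarith
  hence L0: "L \<ge> 0" using n0 by (simp add: zero_less_mult_iff)
  have "real n * L / 8 < real m / 2" using n by (intro mult_less_half_edges[OF \<delta> _ m(1) L(1)]) simp
  hence fn: "real f + real n < real m / 2" using F(2) f_def by linarith
  hence fnm: "f + n < m" by linarith
  \<comment> \<open>Chosen so that \<open>1 + x\<close> is the inverse of \<open>q\<close>, the
    factor of \<open>inclusion_prob\<close> at index \<open>f + n\<close>.\<close>
  define x where "x = (real M - real m) / (real m - real (f + n))"
  have x0: "x \<ge> 0" using fnm mM by (simp add: x_def)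
  have "real M \<le> real m / \<delta>" using mM(1) \<delta> by (simp add: field_simps)
  hence Mm: "real M - real m \<le> real m / \<delta>" using m0 by linarith
  have x2: "x \<le> 2 / \<delta>"
  proof -
    have "x \<le> (real m / \<delta>) / (real m / 2)"
      unfolding x_def using Mm fn m0 mM \<delta> by (intro frac_le) auto
    thus ?thesis using m0 by simp
  qed
  have fL: "real f \<le> real n * L / 8" using F(2) by (simp add: f_def)
  have "2 * x * f / n \<le> L / (2 * \<delta>)"
  proof -
    have "x * f \<le> (2 / \<delta>) * (real n * L / 8)" using x2 fL x0 \<delta> by (intro mult_mono) auto
    thus ?thesis using n0 \<delta> by (simp add: field_simps)
  qed
  hence "real n * exp (exp 2 * (2 * x * f / n)) \<le> real n * exp (exp 2 * (L / (2 * \<delta>)))"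
    by (intro mult_left_mono iffD2[OF exp_le_cancel_iff]) auto
  also note L(3)
  finally have large: "real n * exp (exp 2 * (2 * x * card F / n)) \<le> exp (sqrt (n / 2))" by (simp add: f_def)

  define q where "q = (real m - real (f + n)) / (real M - real (f + n))"
  have q0: "q > 0" using fnm mM by (simp add: q_def)
  have ne: "real m - real (f + n) \<noteq> 0" "real M - real (f + n) \<noteq> 0" using fnm mM(2) by linarith+
  have "1 + x = ((real m - real (f + n)) + (real M - real m)) / (real m - real (f + n))"
    unfolding x_def add_divide_distrib by (simp only: divide_self[OF ne(1)])
  also have "(real m - real (f + n)) + (real M - real m) = real M - real (f + n)" by simp
  finally have "1 + x = (real M - real (f + n)) / (real m - real (f + n))" .
  hence qx: "q * (1 + x) = 1" unfolding q_def using ne by simp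
  define Q where "Q = inclusion_prob M m"
  define b where "b = real (M choose m)"
  have cnt: "real (card (supergraphs n m A)) = b * Q (card A)" if "A \<subseteq> all_edges n" "card A \<le> m" for A
    using card_supergraphs[OF that] binomial_diff_conv_inclusion_prob[OF that(2) mM(2)]
    by (simp add: M_def b_def Q_def)
  \<comment> \<open>Since the sizes of \<open>F \<union> H\<close> and \<open>F \<inter> H\<close>
    add up to \<open>f + n\<close>, restoring the shared edges costs at least a factor
    \<open>q\<close> each, and \<open>1 + x\<close> compensates for each of them.\<close>
  have each: "real (card (supergraphs n m (F \<union> H))) \<le> b * Q (f + n) * (1 + x) ^ card (F \<inter> H)"
    if H: "H \<in> hams n" for H
  proof -
    have HE: "H \<subseteq> all_edges n" "card H = n" using hams_memD[OF n H] .
    have finH: "finite H" using HE finite_all_edges finite_subset by blast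
    let ?s = "card (F \<inter> H)"
    have card: "card (F \<union> H) + ?s = f + n" using card_Un_Int[OF finF finH] HE by (simp add: f_def)
    have "Q (card (F \<union> H)) * q ^ ?s \<le> Q (card (F \<union> H) + ?s)"
      unfolding Q_def q_def using card fnm mM by (intro inclusion_prob_mult_power_le) auto
    hence "(Q (card (F \<union> H)) * q ^ ?s) * (1 + x) ^ ?s \<le> Q (f + n) * (1 + x) ^ ?s"
      unfolding card using x0 by (intro mult_right_mono) auto
    moreover have "q ^ ?s * (1 + x) ^ ?s = 1" by (simp add: power_mult_distrib[symmetric] qx)
    ultimately have "Q (card (F \<union> H)) \<le> Q (f + n) * (1 + x) ^ ?s" by (simp add: mult.assoc)
    hence "b * Q (card (F \<union> H)) \<le> b * (Q (f + n) * (1 + x) ^ ?s)"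
      by (intro mult_left_mono) (simp_all add: b_def)
    moreover have "real (card (supergraphs n m (F \<union> H))) = b * Q (card (F \<union> H))"
      using F HE card fnm by (intro cnt) auto
    ultimately show ?thesis by simp
  qed
  have Q0: "Q j \<ge> 0" if "j \<le> m" for j unfolding Q_def using that mM by (intro inclusion_prob_nonneg)
  define h where "h = real (card (hams n))"
  \<comment> \<open>The main terms cancel because \<open>2 / n \<le> n / M\<close>. What remains
    comes from the difference of \<open>1 / (m - f - n)\<close> and \<open>1 / m\<close>, and is of
    order \<open>L^2 / n\<close> for fixed \<delta>.\<close>
  have expo: "2 * x * f / n - real n * (real f * (real M - real m) / (real m * real M)) \<le> 1"
  proof -
    have "2 * real M \<le> real n * real n" unfolding M by (simp add: algebra_simps)
    hence nM: "2 / real n \<le> real n / real M" using n0 M0 by (simp add: field_simps)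
    define r where "r = real f * (real M - real m)"
    have r0: "r \<ge> 0" using mM by (simp add: r_def)
    have "(2 / real n) * (r / real m) \<le> (real n / real M) * (r / real m)"
      using nM r0 by (intro mult_right_mono) auto
    hence "2 * x * f / n - real n * (r / (real m * real M)) \<le> 2 * x * f / n - (2 / real n) * (r / real m)"
      by (simp add: mult_ac)
    also have "\<dots> = (2 / real n) * (r * ((f + n) / (real m * (real m - real (f + n)))))"
    proof -
      have "1 / (real m - real (f + n)) - 1 / real m = (f + n) / (real m * (real m - real (f + n)))"
        using diff_frac_eq[OF ne(1), of "real m" 1 1] m0 by (simp add: mult.commute)
      moreover have "x * f - r / real m = r * (1 / (real m - real (f + n)) - 1 / real m)"
      proof -
        have "x * f = r / (real m - real (f + n))"
          by (simp only: x_def r_def times_divide_eq_right mult.commute)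
        thus ?thesis by (simp only: right_diff_distrib times_divide_eq_right mult_1_right)
      qed
      ultimately have "x * f - r / real m = r * ((f + n) / (real m * (real m - real (f + n))))" by simp
      moreover have "2 * x * f / n - (2 / real n) * (r / real m) = (2 / real n) * (x * f - r / real m)"
        by (simp add: right_diff_distrib)
      ultimately show ?thesis by (simp only:)
    qed
    also have "\<dots> \<le> (2 / real n) * (((real n * L / 8) * (real m / \<delta>)) * ((real n * L / 8) / (real m * (real m / 2))))"
    proof (rule mult_left_mono, rule mult_mono)
      show "r \<le> (real n * L / 8) * (real m / \<delta>)"
        unfolding r_def using fL Mm mM L0 by (intro mult_mono) auto
      show "(f + n) / (real m * (real m - real (f + n))) \<le> (real n * L / 8) / (real m * (real m / 2))"
        using F(2) fn m0 L0 by (intro frac_le mult_left_mono) (auto simp: f_def)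
    qed (use L0 m0 \<delta> fn in auto)
    also have "\<dots> = (L\<^sup>2 * real n / (16 * \<delta>)) / real m"
      using m0 n0 \<delta> by (simp add: field_simps power2_eq_square)
    also have "\<dots> \<le> (L\<^sup>2 * real n / (16 * \<delta>)) / (\<delta> * real n ^ 2 / 4)"
      using m4 m0 \<delta> n0 by (intro divide_left_mono) auto
    also have "\<dots> = L\<^sup>2 / (4 * \<delta>\<^sup>2 * n)"
      using n0 \<delta> by (simp add: field_simps power2_eq_square)
    also have "\<dots> \<le> 1" using L(2) n0 \<delta> by simp
    finally show ?thesis by (simp add: r_def)
  qed
  have "(\<Sum>H\<in>hams n. real (card (supergraphs n m (F \<union> H))))
      \<le> (\<Sum>H\<in>hams n. b * Q (f + n) * (1 + x) ^ card (F \<inter> H))"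
    by (rule sum_mono) (rule each)
  also have "\<dots> = b * Q (f + n) * (\<Sum>H\<in>hams n. (1 + x) ^ card (F \<inter> H))"
    by (simp add: sum_distrib_left)
  also have "\<dots> \<le> b * Q (f + n) * (h * (3 * exp (2 * x * f / n)))"
    unfolding h_def f_def using fnm
    by (intro mult_left_mono sum_hams_power_overlap n F(1) x0 large mult_nonneg_nonneg Q0[unfolded f_def])
       (auto simp: b_def f_def)
  also have "\<dots> \<le> b * (Q f * Q n * exp (- (real n * (real f * (real M - real m) / (real m * real M)))))
      * (h * (3 * exp (2 * x * f / n)))"
    unfolding Q_def
    by (intro mult_right_mono mult_left_mono inclusion_prob_add_le fnm mM) (auto simp: b_def h_def)
  also have "\<dots> = 3 * (h * Q n) * (b * Q f)
      * exp (2 * x * f / n - real n * (real f * (real M - real m) / (real m * real M)))"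
    by (simp add: exp_diff exp_minus field_simps)
  also have "\<dots> \<le> 3 * (h * Q n) * (b * Q f) * exp 1"
    using expo fnm by (intro mult_left_mono mult_nonneg_nonneg Q0) (auto simp: h_def b_def)
  also have "b * Q f = real (card (supergraphs n m F))"
    using cnt[OF F(1)] fnm by (simp add: f_def)
  finally show ?thesis by (simp add: h_def Q_def M_def mult_ac)
qed

section \<open>Expanding moments one Hamilton cycle at a time\<close>

lemma num_hamilton_cycles_conv_sum:
  assumes "n \<ge> 3"
  shows "real (num_hamilton_cycles n E) = (\<Sum>H\<in>hams n. if H \<subseteq> E then 1 else 0)"
proof -
  have "{H. H \<subseteq> E \<and> hamilton_cycle n H} = {H \<in> hams n. H \<subseteq> E}" by (auto simp: hams_def)
  thus ?thesis unfolding num_hamilton_cycles_def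
    using finite_hams[OF assms] by (simp add: sum.inter_filter[symmetric])
qed

text \<open>Exchanging the sums turns a factor counting Hamilton cycles into one more cycle that the
  graph must contain. The weight \<open>g\<close> is constant for the first moment and a lower power
  of the count in the induction.\<close>

lemma sum_supergraphs_mult_num_hamilton_cycles:
  assumes "n \<ge> 3"
  shows "(\<Sum>E\<in>supergraphs n m F. g E * real (num_hamilton_cycles n E))
    = (\<Sum>H\<in>hams n. \<Sum>E\<in>supergraphs n m (F \<union> H). g E)"
proof -
  have "(\<Sum>E\<in>supergraphs n m F. g E * real (num_hamilton_cycles n E))
      = (\<Sum>E\<in>supergraphs n m F. \<Sum>H\<in>hams n. if H \<subseteq> E then g E else 0)"
    unfolding num_hamilton_cycles_conv_sum[OF assms] sum_distrib_left
    by (intro sum.cong refl) simp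
  also have "\<dots> = (\<Sum>H\<in>hams n. \<Sum>E\<in>supergraphs n m F. if H \<subseteq> E then g E else 0)"
    by (rule sum.swap)
  also have "\<dots> = (\<Sum>H\<in>hams n. \<Sum>E\<in>supergraphs n m (F \<union> H). g E)"
  proof (rule sum.cong[OF refl])
    fix H
    have "supergraphs n m (F \<union> H) = {E \<in> supergraphs n m F. H \<subseteq> E}"
      by (auto simp: supergraphs_def)
    thus "(\<Sum>E\<in>supergraphs n m F. if H \<subseteq> E then g E else 0) = (\<Sum>E\<in>supergraphs n m (F \<union> H). g E)"
      by (simp add: sum.inter_filter finite_supergraphs)
  qed
  finally show ?thesis .
qed

text \<open>Induction on \<open>j\<close>, for all \<open>F\<close> at once, because fixing a cycle
  \<open>H\<close> replaces \<open>F\<close> by \<open>F \<union> H\<close>. This adds at most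
  \<open>n\<close> edges while \<open>j\<close> drops by one, so the edge budget is
  preserved.\<close>

lemma sum_supergraphs_power_le:
  fixes \<delta> L :: real
  assumes \<delta>: "0 < \<delta>" and n: "n \<ge> 3"
    and m: "\<delta> * real (n choose 2) \<le> real m" "m \<le> n choose 2"
    and L: "L < \<delta> * n" "L\<^sup>2 \<le> 4 * \<delta>\<^sup>2 * n"
      "real n * exp (exp 2 * (L / (2 * \<delta>))) \<le> exp (sqrt (n / 2))"
    and F: "F \<subseteq> all_edges n" "real (card F) + real j * real n \<le> real n * L / 8"
  shows "(\<Sum>E\<in>supergraphs n m F. real (num_hamilton_cycles n E) ^ j)
    \<le> (3 * exp 1 * (real (card (hams n)) * inclusion_prob (n choose 2) m n)) ^ j * real (card (supergraphs n m F))"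
  using F
proof (induction j arbitrary: F)
  case (Suc j)
  let ?c = "3 * exp 1 * (real (card (hams n)) * inclusion_prob (n choose 2) m n)"
  have IH: "(\<Sum>E\<in>supergraphs n m (F \<union> H). real (num_hamilton_cycles n E) ^ j)
      \<le> ?c ^ j * real (card (supergraphs n m (F \<union> H)))" if H: "H \<in> hams n" for H
  proof (rule Suc.IH)
    show "F \<union> H \<subseteq> all_edges n" using Suc.prems hams_memD[OF n H] by auto
    have "card (F \<union> H) \<le> card F + n" using card_Un_le[of F H] hams_memD[OF n H] by simp
    hence "real (card (F \<union> H)) \<le> real (card F) + real n" by linarith
    thus "real (card (F \<union> H)) + real j * real n \<le> real n * L / 8"
      using Suc.prems by (simp add: algebra_simps)
  qed
  have F1: "real (card F) + real n \<le> real n * L / 8"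
  proof -
    have "real n * 1 \<le> real n * real (Suc j)" by (intro mult_left_mono) auto
    hence "real n \<le> real (Suc j) * real n" by (simp only: mult_1_right mult.commute)
    thus ?thesis using Suc.prems by linarith
  qed
  have step: "(\<Sum>H\<in>hams n. real (card (supergraphs n m (F \<union> H)))) \<le> ?c * real (card (supergraphs n m F))"
    by (rule sum_card_supergraphs_hams[OF \<delta> n m Suc.prems(1) F1 L])
  have "real n * L / 8 < real m / 2" using n by (intro mult_less_half_edges[OF \<delta> _ m(1) L(1)]) simp
  hence "real n < real m" using F1 by linarith
  hence c0: "?c \<ge> 0" using m by (intro mult_nonneg_nonneg inclusion_prob_nonneg) auto
  have "(\<Sum>E\<in>supergraphs n m F. real (num_hamilton_cycles n E) ^ Suc j)
    = (\<Sum>H\<in>hams n. \<Sum>E\<in>supergraphs n m (F \<union> H). real (num_hamilton_cycles n E) ^ j)"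
    using sum_supergraphs_mult_num_hamilton_cycles[OF n, where g = "\<lambda>E. real (num_hamilton_cycles n E) ^ j"]
    by (simp add: mult.commute)
  also have "\<dots> \<le> (\<Sum>H\<in>hams n. ?c ^ j * real (card (supergraphs n m (F \<union> H))))"
    by (rule sum_mono) (rule IH)
  also have "\<dots> = ?c ^ j * (\<Sum>H\<in>hams n. real (card (supergraphs n m (F \<union> H))))"
    by (simp add: sum_distrib_left)
  also have "\<dots> \<le> ?c ^ j * (?c * real (card (supergraphs n m F)))"
    using c0 by (intro mult_left_mono step) auto
  finally show ?case by (simp add: mult_ac)
qed simp

theorem lemma2p9:
  fixes \<delta> :: real
  assumes "0 < \<delta>" and "\<delta> < 1 / 2"
  shows "\<exists>C::real. C > 0 \<and>
    (\<exists>N::nat. \<forall>n\<ge>N. \<forall>m::nat. \<forall>k::nat.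
      \<delta> * real (n choose 2) \<le> real m \<longrightarrow>
      real m \<le> (1 - \<delta>) * real (n choose 2) \<longrightarrow>
      1 \<le> k \<longrightarrow> real k \<le> ln (real n) / 8 \<longrightarrow>
      measure_pmf.expectation (Gnm n m) (\<lambda>E. real (num_hamilton_cycles n E) ^ k)
        \<le> C ^ k * (measure_pmf.expectation (Gnm n m) (\<lambda>E. real (num_hamilton_cycles n E))) ^ k)"
proof -
  \<comment> \<open>These are the three conditions on \<open>L\<close> for \<open>L = ln n\<close>.
    In the last one the left-hand side is a fixed power of \<open>n\<close>.\<close>
  have "eventually (\<lambda>n::nat. ln (real n) < \<delta> * real n) sequentially"
    using assms by real_asymp
  moreover have "eventually (\<lambda>n::nat. (ln (real n))\<^sup>2 \<le> 4 * \<delta>\<^sup>2 * real n) sequentially"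
    using assms by real_asymp
  moreover have "eventually (\<lambda>n::nat. real n * exp (exp 2 * (ln (real n) / (2 * \<delta>))) \<le> exp (sqrt (real n / 2))) sequentially"
    using assms by real_asymp
  moreover have "eventually (\<lambda>n::nat. n \<ge> 3) sequentially" by (rule eventually_ge_at_top)
  ultimately have "eventually (\<lambda>n::nat. ln (real n) < \<delta> * real n \<and> (ln (real n))\<^sup>2 \<le> 4 * \<delta>\<^sup>2 * real n \<and>
      real n * exp (exp 2 * (ln (real n) / (2 * \<delta>))) \<le> exp (sqrt (real n / 2)) \<and> n \<ge> 3) sequentially"
    by eventually_elim auto
  then obtain N where N: "\<And>n. n \<ge> N \<Longrightarrow> ln (real n) < \<delta> * real n \<and> (ln (real n))\<^sup>2 \<le> 4 * \<delta>\<^sup>2 * real n \<and>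
      real n * exp (exp 2 * (ln (real n) / (2 * \<delta>))) \<le> exp (sqrt (real n / 2)) \<and> n \<ge> 3"
    unfolding eventually_sequentially by blast
  show ?thesis
  \<comment> \<open>The constant is \<open>3 * exp 1\<close> for every \<delta>; only the threshold
    \<open>N\<close> varies with \<delta>.\<close>
  proof (intro exI[of _ "3 * exp 1 :: real"] conjI exI[of _ N] allI impI)
    fix n m k :: nat
    assume nN: "N \<le> n" and m1: "\<delta> * real (n choose 2) \<le> real m"
      and m2: "real m \<le> (1 - \<delta>) * real (n choose 2)"
      and k: "1 \<le> k" "real k \<le> ln (real n) / 8"
    note L = N[OF nN]
    have n: "n \<ge> 3" using L by blast
    have "(1 - \<delta>) * real (n choose 2) \<le> 1 * real (n choose 2)"
      using assms by (intro mult_right_mono) auto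
    hence mM: "m \<le> n choose 2" using m2 by linarith
    define \<mu> where "\<mu> = real (card (hams n)) * inclusion_prob (n choose 2) m n"
    have G: "supergraphs n m {} = graphs n m" by (simp add: supergraphs_def)
    have cG: "card (graphs n m) = (n choose 2) choose m"
      using card_supergraphs[of "{}" n m] G by simp
    hence cG0: "card (graphs n m) > 0" using mM by simp
    hence Gne: "graphs n m \<noteq> {}" by auto
    have expec: "measure_pmf.expectation (Gnm n m) g = (\<Sum>E\<in>graphs n m. g E) / card (graphs n m)" for g :: "_ \<Rightarrow> real"
      unfolding Gnm_def by (rule integral_pmf_of_set[OF Gne finite_graphs])
    \<comment> \<open>The bound on \<open>k\<close> says that \<open>k\<close> Hamilton cycles
      together fit into the edge budget, starting from the empty \<open>F\<close>. As
      \<open>k\<close> is at least 1, even a single cycle fits, whence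
      \<open>n \<le> m\<close>.\<close>
    have kn: "real k * real n \<le> real n * ln (real n) / 8"
      using mult_right_mono[OF k(2), of "real n"] by (simp add: mult_ac)
    have "real n * 1 \<le> real n * real k" using k(1) by (intro mult_left_mono) auto
    moreover have "real n * ln (real n) / 8 < real m / 2"
      using mult_less_half_edges[of \<delta> n m "ln (real n)"] assms n m1 L by simp
    moreover have "real k * real n = real n * real k" by (rule mult.commute)
    ultimately have nm: "n \<le> m" using kn by linarith
    have EX: "measure_pmf.expectation (Gnm n m) (\<lambda>E. real (num_hamilton_cycles n E)) = \<mu>"
    proof -
      have "(\<Sum>E\<in>graphs n m. real (num_hamilton_cycles n E)) = (\<Sum>H\<in>hams n. real (card (supergraphs n m H)))"
        using sum_supergraphs_mult_num_hamilton_cycles[OF n, where F = "{}" and g = "\<lambda>_. 1" and m = m] G by simp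
      also have "\<dots> = (\<Sum>H\<in>hams n. real (card (graphs n m)) * inclusion_prob (n choose 2) m n)"
      proof (rule sum.cong[OF refl])
        fix H assume "H \<in> hams n"
        hence "H \<subseteq> all_edges n" "card H = n" using hams_memD[OF n] by blast+
        thus "real (card (supergraphs n m H)) = real (card (graphs n m)) * inclusion_prob (n choose 2) m n"
          using card_supergraphs[of H n m] binomial_diff_conv_inclusion_prob[OF nm mM] nm cG by simp
      qed
      finally show ?thesis using cG0 by (simp add: expec \<mu>_def)
    qed
    have "(\<Sum>E\<in>graphs n m. real (num_hamilton_cycles n E) ^ k) \<le> (3 * exp 1 * \<mu>) ^ k * real (card (graphs n m))"
      using sum_supergraphs_power_le[OF assms(1) n m1 mM, of "ln (real n)" "{}" k] L kn G by (simp add: \<mu>_def)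
    thus "measure_pmf.expectation (Gnm n m) (\<lambda>E. real (num_hamilton_cycles n E) ^ k)
        \<le> (3 * exp 1) ^ k * (measure_pmf.expectation (Gnm n m) (\<lambda>E. real (num_hamilton_cycles n E))) ^ k"
      unfolding EX using cG0 by (simp add: expec power_mult_distrib pos_divide_le_eq)
  qed simp
qed

end
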